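(* Let $V=(A,B,C,a,b,c)\in F^6$ with $D\langle V\rangle=B^2-4AC\neq 0$, and consider the equation $A(\partial^1)^2u+B\partial^1\partial^2u+C(\partial^2)^2u+a\partial^1u+b\partial^2u+cu=0$. Suppose that $$\partial^2\frac{a^{\partial}\langle V\rangle}{D\langle V\rangle}=\partial^1\frac{b^{\partial}\langle V\rangle}{D\langle V\rangle}\quad\text{and}\quad \gamma_0^{\partial}\langle V\rangle=0 .$$ Then the equation is $G$-equivalent to a linear partial differential equation with constant coefficients if and only if the system $$(\partial^ig\,g^{-1})^tM^{\partial}\langle V\rangle+M^{\partial}\langle V\rangle\,\partial^ig\,g^{-1}+\partial^iM^{\partial}\langle V\rangle-\Big(\Delta^{-1}\partial^i\Delta+\tfrac12D\langle V\rangle^{-1}\partial^iD\langle V\rangle\Big)M^{\partial}\langle V\rangle=0,\quad i=1,2,$$ $$\partial^ig\,g^{-1}\,m^{\partial}\langle V\rangle=\partial^im^{\partial}\langle V\rangle,\quad i=1,2,$$ has a solution $g\in GL^{\partial}(2,F)$, where $\Delta=\det g$, $$M^{\partial}\langle V\rangle=\begin{pmatrix} A & B/2 \\ B/2 & C \end{pmatrix},\qquad m^{\partial}\langle V\rangle=\begin{pmatrix}\frac{a^{\partial}\langle V\rangle}{D\langle V\rangle}\\[2pt] \frac{b^{\partial}\langle V\rangle}{D\langle V\rangle}\end{pmatrix}+\Delta^{-1}\partial\Delta+\tfrac12D\langle V\rangle^{-1}\partial D\langle V\rangle .$$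
   Context: $(F,\partial^1,\partial^2)$ is a field of characteristic different from 2 with two commuting derivations, linearly independent over $F$; $\partial$ is the column $(\partial^1,\partial^2)^t$, so $\partial f=(\partial^1f,\partial^2f)^t$; derivations act on matrices entrywise; $t$ is transpose. Subscripts $x,y$ denote $\partial^1,\partial^2$: $u_x=\partial^1u$, $u_y=\partial^2u$. The constant field is $\{f\in F:\partial^1f=\partial^2f=0\}$ (not to be confused with the coefficient $C$). $GL^{\partial}(2,F)=\{g=(g^i_j)\in GL(2,F):\partial^kg^i_j=\partial^ig^k_j,\ i,j,k=1,2\}$, with $g^i_j$ in row $i$, column $j$. For $V=(A,B,C,a,b,c)\in F^6$, $h\in F^*=F\setminus\{0\}$, $g\in GL^{\partial}(2,F)$, define $V_1=\tau^{\partial}\langle h,g;V\rangle=(A_1,B_1,C_1,a_1,b_1,c_1)$ by $$\begin{aligned} A_1&=h(A(g^1_1)^2+Bg^1_1g^2_1+C(g^2_1)^2),\\ B_1&=h(2Ag^1_1g^1_2+B(g^1_1g^2_2+g^1_2g^2_1)+2Cg^2_1g^2_2),\\ C_1&=h(A(g^1_2)^2+Bg^1_2g^2_2+C(g^2_2)^2),\\ a_1&=h(A\partial^1g^1_1+B\partial^1g^2_1+C\partial^2g^2_1+ag^1_1+bg^2_1)+2A\,\partial^1h\,g^1_1+B(\partial^1h\,g^2_1+\partial^2h\,g^1_1)+2C\,\partial^2h\,g^2_1,\\ b_1&=h(A\partial^1g^1_2+B\partial^1g^2_2+C\partial^2g^2_2+ag^1_2+bg^2_2)+2A\,\partial^1h\,g^1_2+B(\partial^1h\,g^2_2+\partial^2h\,g^1_2)+2C\,\partial^2h\,g^2_2,\\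 c_1&=A(\partial^1)^2h+B\partial^1\partial^2h+C(\partial^2)^2h+a\,\partial^1h+b\,\partial^2h+ch. \end{aligned}$$ (These are the coefficients of the equation in $v=h^{-1}u$ with respect to the derivations $\delta=g^{-1}\partial$.) The equation with coefficients $V$ is $G$-equivalent ($G=F^*\times GL^{\partial}(2,F)$) to the equation $A_1(\delta^1)^2v+B_1\delta^1\delta^2v+C_1(\delta^2)^2v+a_1\delta^1v+b_1\delta^2v+c_1v=0$ if $\delta=g^{-1}\partial$ and $V_1=\tau^{\partial}\langle h,g;V\rangle$ for some $h\in F^*$, $g\in GL^\partial(2,F)$. It has constant coefficients if all components of $V_1$ lie in the constant field. Further notation: $$\begin{aligned} D\langle V\rangle&=B^2-4AC,\\ a^{\partial}\langle V\rangle&=AC_x-A_xC+BC_y-B_yC-bB+2aC,\\ b^{\partial}\langle V\rangle&=A_xB-AB_x+A_yC-AC_y-aB+2bA, \end{aligned}$$ and, with $p=\frac{a^{\partial}\langle V\rangle}{D\langle V\rangle}$, $q=\frac{b^{\partial}\langle V\rangle}{D\langle V\rangle}$, $$\gamma_0^{\partial}\langle V\rangle=A(p_x+p^2)+B(p_y+pq)+C(q_y+q^2)+ap+bq+c .$$ *)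

theory Defs
  imports "HOL-Analysis.Analysis"
begin

text \<open>
  A pair of derivations is a column \<open>d :: ('a \<Rightarrow> 'a) ^ 2\<close>, so that \<open>d $ i\<close> is
  the i-th derivation. The linear equation
    \<open>A (d $ 1)\<^sup>2 u + B (d $ 1) (d $ 2) u + C (d $ 2)\<^sup>2 u + a (d $ 1) u + b (d $ 2) u + c u = 0\<close>
  is represented by the column \<open>d\<close> together with its coefficients \<open>(A, B, C, a, b, c)\<close>.
\<close>

type_synonym 'a derivs = "('a \<Rightarrow> 'a) ^ 2"
type_synonym 'a coeffs = "'a \<times> 'a \<times> 'a \<times> 'a \<times> 'a \<times> 'a"

definition derivation :: "('a::comm_ring_1 \<Rightarrow> 'a) \<Rightarrow> bool" where
  "derivation D \<longleftrightarrow>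
     (\<forall>f g. D (f + g) = D f + D g) \<and> (\<forall>f g. D (f * g) = D f * g + f * D g)"

definition commuting_independent_derivations :: "'a::field derivs \<Rightarrow> bool" where
  "commuting_independent_derivations d \<longleftrightarrow>
     derivation (d $ 1) \<and> derivation (d $ 2) \<and>
     (\<forall>f. (d $ 1) ((d $ 2) f) = (d $ 2) ((d $ 1) f)) \<and>
     (\<forall>\<alpha> \<beta>. (\<forall>f. \<alpha> * (d $ 1) f + \<beta> * (d $ 2) f = 0) \<longrightarrow> \<alpha> = 0 \<and> \<beta> = 0)"

definition constant_field :: "'a::field derivs \<Rightarrow> 'a set" where
  "constant_field d = {f. (d $ 1) f = 0 \<and> (d $ 2) f = 0}"

definition grad :: "'a derivs \<Rightarrow> 'a \<Rightarrow> 'a ^ 2" where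
  "grad d f = (\<chi> i. (d $ i) f)"

definition deriv_vec :: "('a \<Rightarrow> 'a) \<Rightarrow> 'a ^ 2 \<Rightarrow> 'a ^ 2" where
  "deriv_vec D v = (\<chi> i. D (v $ i))"

definition GL_d :: "'a::field derivs \<Rightarrow> ('a ^ 2 ^ 2) set" where
  "GL_d d = {g. invertible g \<and>
     (\<forall>i j k. (d $ k) (g $ i $ j) = (d $ i) (g $ k $ j))}"

definition transform_derivs :: "'a::field ^ 2 ^ 2 \<Rightarrow> 'a derivs \<Rightarrow> 'a derivs" where
  "transform_derivs g d = (\<chi> i. (\<lambda>f. (matrix_inv g *v grad d f) $ i))"

text \<open>Entry \<open>g\<^sup>i\<^sub>j\<close> (row i, column j) is \<open>g $ i $ j\<close>.\<close>

fun tau :: "'a::field derivs \<Rightarrow> 'a \<Rightarrow> 'a ^ 2 ^ 2 \<Rightarrow> 'a coeffs \<Rightarrow> 'a coeffs" where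
  "tau d h g (A, B, C, a, b, c) =
    (h * (A * (g$1$1)^2 + B * g$1$1 * g$2$1 + C * (g$2$1)^2),
     h * (2 * A * g$1$1 * g$1$2 + B * (g$1$1 * g$2$2 + g$1$2 * g$2$1) + 2 * C * g$2$1 * g$2$2),
     h * (A * (g$1$2)^2 + B * g$1$2 * g$2$2 + C * (g$2$2)^2),
     h * (A * (d$1) (g$1$1) + B * (d$1) (g$2$1) + C * (d$2) (g$2$1) + a * g$1$1 + b * g$2$1)
       + 2 * A * (d$1) h * g$1$1 + B * ((d$1) h * g$2$1 + (d$2) h * g$1$1)
       + 2 * C * (d$2) h * g$2$1,
     h * (A * (d$1) (g$1$2) + B * (d$1) (g$2$2) + C * (d$2) (g$2$2) + a * g$1$2 + b * g$2$2)
       + 2 * A * (d$1) h * g$1$2 + B * ((d$1) h * g$2$2 + (d$2) h * g$1$2)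
       + 2 * C * (d$2) h * g$2$2,
     A * (d$1) ((d$1) h) + B * (d$1) ((d$2) h) + C * (d$2) ((d$2) h)
       + a * (d$1) h + b * (d$2) h + c * h)"

definition G_equivalent ::
    "'a::field derivs \<Rightarrow> 'a coeffs \<Rightarrow> 'a derivs \<Rightarrow> 'a coeffs \<Rightarrow> bool" where
  "G_equivalent d V \<delta> V\<^sub>1 \<longleftrightarrow>
     (\<exists>h g. h \<noteq> 0 \<and> g \<in> GL_d d \<and> \<delta> = transform_derivs g d \<and> V\<^sub>1 = tau d h g V)"

text \<open>
  Constancy refers to the original column \<open>d\<close>; for \<open>g\<close> invertible,
  \<open>transform_derivs g d\<close> has the same constant field.
\<close>

fun constant_coeffs :: "'a::field derivs \<Rightarrow> 'a coeffs \<Rightarrow> bool" where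
  "constant_coeffs d (A, B, C, a, b, c) \<longleftrightarrow> {A, B, C, a, b, c} \<subseteq> constant_field d"

fun discr :: "'a::field coeffs \<Rightarrow> 'a" where
  "discr (A, B, C, a, b, c) = B^2 - 4 * A * C"

fun a_d :: "'a::field derivs \<Rightarrow> 'a coeffs \<Rightarrow> 'a" where
  "a_d d (A, B, C, a, b, c) =
     A * (d$1) C - (d$1) A * C + B * (d$2) C - (d$2) B * C - b * B + 2 * a * C"

fun b_d :: "'a::field derivs \<Rightarrow> 'a coeffs \<Rightarrow> 'a" where
  "b_d d (A, B, C, a, b, c) =
     (d$1) A * B - A * (d$1) B + (d$2) A * C - A * (d$2) C - a * B + 2 * b * A"

fun gamma0 :: "'a::field derivs \<Rightarrow> 'a coeffs \<Rightarrow> 'a" where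
  "gamma0 d (A, B, C, a, b, c) =
     (let V = (A, B, C, a, b, c); p = a_d d V / discr V; q = b_d d V / discr V
      in A * ((d$1) p + p^2) + B * ((d$2) p + p * q) + C * ((d$2) q + q^2) + a * p + b * q + c)"

fun M_mat :: "'a::field coeffs \<Rightarrow> 'a ^ 2 ^ 2" where
  "M_mat (A, B, C, a, b, c) = vector [vector [A, B / 2], vector [B / 2, C]]"

text \<open>The vector depends on the unknown \<open>g\<close> through \<open>det g\<close>.\<close>

definition m_vec :: "'a::field derivs \<Rightarrow> 'a coeffs \<Rightarrow> 'a ^ 2 ^ 2 \<Rightarrow> 'a ^ 2" where
  "m_vec d V g =
     vector [a_d d V / discr V, b_d d V / discr V]
     + inverse (det g) *s grad d (det g)
     + (1 / 2 * inverse (discr V)) *s grad d (discr V)"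

end

theory Submission
  imports Defs
begin

text \<open>
  Write \<open>N = g\<^sup>t M g\<close>, \<open>P = (a\<^sup>\<partial>/D, b\<^sup>\<partial>/D)\<^sup>t\<close> and \<open>\<mu> = g\<^sup>-\<^sup>1 (P - h\<^sup>-\<^sup>1 \<partial>h)\<close>.
  The leading coefficients of \<open>V\<^sub>1 = \<tau>\<langle>h, g; V\<rangle>\<close> form \<open>M\<^sub>1 = h N\<close>, with discriminant \<open>h\<^sup>2 \<Delta>\<^sup>2 D\<close>.
  If \<open>M\<^sub>1\<close> is constant, then so is this discriminant, hence
  \<open>h\<^sup>-\<^sup>1 \<partial>h = - \<Delta>\<^sup>-\<^sup>1 \<partial>\<Delta> - D\<^sup>-\<^sup>1 \<partial>D / 2\<close> and \<open>g \<mu> = m\<close>. Constancy of \<open>h N\<close> is then the first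
  system, conjugated by \<open>g\<close>. Moreover \<open>(a\<^sub>1, b\<^sub>1)\<^sup>t = - 2 M\<^sub>1 \<mu>\<close>, so \<open>a\<^sub>1\<close> and \<open>b\<^sub>1\<close> are constant iff \<open>\<mu>\<close>
  is, which is the second system; in that case
  \<open>c\<^sub>1 = h \<gamma>\<^sub>0 - (\<mu>\<^sup>t M\<^sub>1 \<mu> + a\<^sub>1 \<mu>\<^sub>1 + b\<^sub>1 \<mu>\<^sub>2)\<close> is constant because \<open>\<gamma>\<^sub>0 = 0\<close>. Conversely, the first
  system gives all entries of \<open>N\<close> the same logarithmic derivatives, so \<open>h\<close> can be taken in the
  field itself, as the inverse of a nonzero entry of \<open>N\<close>.
\<close>

section \<open>Calculus of derivations\<close>

lemma derivation_add: "derivation D \<Longrightarrow> D (f + g) = D f + D g"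
  by (simp add: derivation_def)

lemma derivation_mult: "derivation D \<Longrightarrow> D (f * g) = D f * g + f * D g"
  by (simp add: derivation_def)

lemma derivation_0: "derivation D \<Longrightarrow> D 0 = 0"
  using derivation_add[of D 0 0] by simp

lemma derivation_1: "derivation D \<Longrightarrow> D 1 = 0"
  using derivation_mult[of D 1 1] by simp

lemma derivation_minus: "derivation D \<Longrightarrow> D (- f) = - D f"
  using derivation_add[of D f "- f"] by (simp add: derivation_0 eq_neg_iff_add_eq_0 add.commute)

lemma derivation_diff: "derivation D \<Longrightarrow> D (f - g) = D f - D g"
  using derivation_add[of D f "- g"] by (simp add: derivation_minus)

lemma derivation_of_nat: "derivation D \<Longrightarrow> D (of_nat n) = 0"
  by (induction n) (simp_all add: derivation_0 derivation_1 derivation_add)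

lemma derivation_numeral: "derivation D \<Longrightarrow> D (numeral n) = 0"
  using derivation_of_nat[of D "numeral n"] by simp

lemma derivation_power2: "derivation D \<Longrightarrow> D (f\<^sup>2) = 2 * f * D f"
  by (simp add: power2_eq_square derivation_mult algebra_simps)

lemma derivation_inverse:
  fixes f :: "'a::field"
  assumes "derivation D"
  shows "D (inverse f) = - D f * (inverse f)\<^sup>2"
\<comment> \<open>At \<open>f = 0\<close> the convention \<open>inverse 0 = 0\<close> makes both
  sides vanish.\<close>
proof (cases "f = 0")
  case False
  then have "D f * inverse f + f * D (inverse f) = 0"
    using derivation_mult[OF assms, of f "inverse f"] by (simp add: derivation_1 assms)
  with False show ?thesis by (simp add: field_simps power2_eq_square eq_neg_iff_add_eq_0)
qed (simp add: derivation_0 assms)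

lemma derivation_divide:
  fixes f g :: "'a::field"
  assumes "derivation D"
  shows "D (f / g) = D f / g - f * D g / g\<^sup>2"
  using assms by (simp add: divide_inverse derivation_mult derivation_inverse power_inverse)

lemmas derivation_simps = derivation_add derivation_mult derivation_0 derivation_1
  derivation_minus derivation_diff derivation_numeral derivation_power2

lemma derivation_sum: "derivation D \<Longrightarrow> D (sum f S) = (\<Sum>x\<in>S. D (f x))"
  by (induction S rule: infinite_finite_induct) (simp_all add: derivation_0 derivation_add)

section \<open>Derivations of matrices and change of basis by \<open>g\<close>\<close>

lemma map_matrix_mult:
  fixes X :: "'a::comm_ring_1 ^ 'n ^ 'm" and Y :: "'a ^ 'k ^ 'n"
  assumes "derivation D"
  shows "map_matrix D (X ** Y) = map_matrix D X ** Y + X ** map_matrix D Y"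
  using assms
  by (simp add: vec_eq_iff matrix_matrix_mult_def derivation_sum derivation_mult sum.distrib)

lemma map_matrix_transpose: "map_matrix D (transpose X) = transpose (map_matrix D X)"
  by (simp add: vec_eq_iff transpose_def)

lemma deriv_vec_mult:
  fixes X :: "'a::comm_ring_1 ^ 2 ^ 2"
  assumes "derivation D"
  shows "deriv_vec D (X *v v) = map_matrix D X *v v + X *v deriv_vec D v"
  using assms
  by (simp add: vec_eq_iff deriv_vec_def matrix_vector_mult_def derivation_sum derivation_mult
      sum.distrib)

lemma matrix_inv_mult:
  fixes g :: "'a::field ^ 'n ^ 'n"
  assumes "invertible g"
  shows "g ** matrix_inv g = mat 1" "matrix_inv g ** g = mat 1"
  using someI_ex[OF assms[unfolded invertible_def]] by (simp_all add: matrix_inv_def)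

lemma congruence_eq_0_iff:
  fixes g X :: "'a::field ^ 'n ^ 'n"
  assumes "invertible g"
  shows "transpose g ** X ** g = 0 \<longleftrightarrow> X = 0"
proof
  assume *: "transpose g ** X ** g = 0"
  have "X = transpose (g ** matrix_inv g) ** X ** (g ** matrix_inv g)"
    using assms by (simp add: matrix_inv_mult)
  also have "\<dots> = transpose (matrix_inv g) ** (transpose g ** X ** g) ** matrix_inv g"
    by (simp add: matrix_transpose_mul matrix_mul_assoc)
  finally show "X = 0" by (simp add: *)
qed simp

lemma matrix_smult_eq_map:
  "map_matrix (\<lambda>x. l * x) X ** Y = map_matrix (\<lambda>x. l * x) (X ** Y)"
  "X ** map_matrix (\<lambda>x. l * x) Y = map_matrix (\<lambda>x. l * x) (X ** Y)"
  for l :: "'a::comm_ring_1"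
  by (simp_all add: vec_eq_iff matrix_matrix_mult_def sum_distrib_left mult_ac)

lemma matrix_add_distrib:
  fixes X Y :: "'a::comm_ring_1 ^ 'n ^ 'm"
  shows "(X + Y) ** Z = X ** Z + Y ** Z" "W ** (X + Y) = W ** X + W ** Y"
  by (simp_all add: vec_eq_iff matrix_matrix_mult_def sum.distrib algebra_simps)

lemma matrix_diff_distrib:
  fixes X Y :: "'a::comm_ring_1 ^ 'n ^ 'm"
  shows "(X - Y) ** Z = X ** Z - Y ** Z" "W ** (X - Y) = W ** X - W ** Y"
  by (simp_all add: vec_eq_iff matrix_matrix_mult_def sum_subtractf algebra_simps)

text \<open>Since \<open>D g = G g\<close>, the product rule shows that congruence by
  \<open>g\<close> carries the left-hand expression to the difference of the two sides on the right,
  and congruence by an invertible matrix reflects zero.\<close>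

lemma congruence_derivation_iff:
  fixes g M :: "'a::field ^ 'n ^ 'n"
  assumes D: "derivation D" and g: "invertible g"
  defines "G \<equiv> map_matrix D g ** matrix_inv g"
  shows "transpose G ** M + M ** G + map_matrix D M - map_matrix (\<lambda>x. l * x) M = 0 \<longleftrightarrow>
    map_matrix D (transpose g ** M ** g) = map_matrix (\<lambda>x. l * x) (transpose g ** M ** g)"
proof -
  have Dg: "map_matrix D g = G ** g"
    unfolding G_def by (simp add: matrix_inv_mult[OF g] flip: matrix_mul_assoc)
  have "transpose g ** (transpose G ** M + M ** G + map_matrix D M - map_matrix (\<lambda>x. l * x) M) ** g
    = map_matrix D (transpose g ** M ** g) - map_matrix (\<lambda>x. l * x) (transpose g ** M ** g)"
    by (simp add: map_matrix_mult[OF D] map_matrix_transpose Dg matrix_transpose_mul matrix_add_distrib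
       matrix_smult_eq_map matrix_diff_distrib matrix_mul_assoc)
  then show ?thesis
    using congruence_eq_0_iff[OF g] by (metis right_minus_eq)
qed

text \<open>Differentiating \<open>m = g \<mu>\<close> gives \<open>Dg \<mu> + g D\<mu>\<close>,
  whose first summand is \<open>Dg g^-1 m\<close>; the equation thus says
  \<open>g D\<mu> = 0\<close>.\<close>

lemma derivation_coordinates_iff:
  fixes g :: "'a::field ^ 2 ^ 2"
  assumes D: "derivation D" and g: "invertible g" and m: "g *v \<mu> = m"
  shows "(map_matrix D g ** matrix_inv g) *v m = deriv_vec D m \<longleftrightarrow> deriv_vec D \<mu> = 0"
proof -
  have 1: "(map_matrix D g ** matrix_inv g) *v m = map_matrix D g *v \<mu>"
    by (simp add: matrix_vector_mul_assoc matrix_inv_mult[OF g] flip: m matrix_mul_assoc)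
  have "deriv_vec D m = map_matrix D g *v \<mu> + g *v deriv_vec D \<mu>"
    by (simp add: deriv_vec_mult[OF D] flip: m)
  moreover have "g *v v = 0 \<longleftrightarrow> v = 0" for v
    by (metis g matrix_inv_mult(2) matrix_vector_mul_assoc matrix_vector_mul_lid matrix_vector_mult_0_right)
  ultimately show ?thesis by (simp add: 1)
qed

section \<open>Constants and the characteristic\<close>

lemma constant_field_closed:
  assumes "derivation (d $ 1)" "derivation (d $ 2)" "x \<in> constant_field d" "y \<in> constant_field d"
  shows "x + y \<in> constant_field d" "x - y \<in> constant_field d" "- x \<in> constant_field d"
    "x * y \<in> constant_field d" "x / y \<in> constant_field d"
  using assms by (auto simp: constant_field_def derivation_simps derivation_divide)

lemma constant_field_numeral:
  assumes "derivation (d $ 1)" "derivation (d $ 2)"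
  shows "numeral n \<in> constant_field d"
  using assms by (simp add: constant_field_def derivation_simps)

lemma two_neq_0_iff_CHAR: "(2 :: 'a::field) \<noteq> 0 \<longleftrightarrow> CHAR('a) \<noteq> 2"
proof -
  have "(2 :: 'a) = 0 \<longleftrightarrow> CHAR('a) dvd 2"
    using of_nat_eq_0_iff_char_dvd[of 2, where ?'a = 'a] by simp
  also have "\<dots> \<longleftrightarrow> CHAR('a) = 2"
    using prime_nat_iff two_is_prime_nat CHAR_not_1[where ?'a = 'a] by auto
  finally show ?thesis by simp
qed

lemma four_neq_0:
  assumes "(2 :: 'a::field) \<noteq> 0"
  shows "(4 :: 'a) \<noteq> 0"
proof -
  have "(4 :: 'a) = 2 * 2" by simp
  with assms show ?thesis by (metis mult_eq_0_iff)
qed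

section \<open>Coefficients of the transformed equation\<close>

lemma M_mat_tau:
  fixes V :: "'a::field coeffs"
  assumes "(2 :: 'a) \<noteq> 0"
  shows "M_mat (tau d h g V) = map_matrix (\<lambda>x. h * x) (transpose g ** M_mat V ** g)"
  using assms four_neq_0[OF assms]
  by (cases V) (simp add: vec_eq_iff forall_2 matrix_matrix_mult_def transpose_def sum_2 field_simps
      power2_eq_square)

lemma discr_tau: "discr (tau d h g V) = h\<^sup>2 * (det g)\<^sup>2 * discr V"
proof -
  obtain A B C a b c where V: "V = (A, B, C, a, b, c)" by (cases V)
  show ?thesis unfolding V tau.simps discr.simps det_2 by algebra
qed

text \<open>
  Here \<open>(e, f), (k, l)\<close> and \<open>(k, l), (r, t)\<close> are the rows of \<open>\<partial>\<^sup>1g g\<^sup>-\<^sup>1\<close> and \<open>\<partial>\<^sup>2g g\<^sup>-\<^sup>1\<close>, which share a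
  row because \<open>g \<in> GL\<^sup>\<partial>\<close>, and \<open>w\<^sub>i = h\<^sup>-\<^sup>1 \<partial>\<^sup>ih\<close>.
\<close>

lemma first_order_identity:
  fixes A B C :: "'a::field"
  assumes "Ax = -(2*A*e + B*k) - w1*A" "Ay = -(2*A*k + B*r) - w2*A"
    "Bx = -(2*A*f + B*l + B*e + 2*C*k) - w1*B" "By = -(2*A*l + B*t + B*k + 2*C*r) - w2*B"
    "Cx = -(B*f + 2*C*l) - w1*C" "Cy = -(B*l + 2*C*t) - w2*C"
    and D: "D = B\<^sup>2 - 4*A*C" "D \<noteq> 0"
    and "D*p = A*Cx - Ax*C + B*Cy - By*C - b*B + 2*a*C"
    and "D*q = Ax*B - A*Bx + Ay*C - A*Cy - a*B + 2*b*A"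
  shows "A*e + B*k + C*r + a + 2*A*p + B*q = 0" "A*f + B*l + C*t + b + B*p + 2*C*q = 0"
proof -
  \<comment> \<open>Multiplying by \<open>D\<close> clears the denominators of \<open>p\<close> and
    \<open>q\<close>; after substituting the derivatives of \<open>A\<close>, \<open>B\<close>,
    \<open>C\<close> a polynomial identity remains.\<close>
  have "D * (A*e + B*k + C*r + a + 2*A*p + B*q)
      = D * (A*e + B*k + C*r + a) + 2*A*(D*p) + B*(D*q)" by algebra
  also have "\<dots> = 0" unfolding assms(9,10) unfolding assms(1-6) D(1) by algebra
  finally show "A*e + B*k + C*r + a + 2*A*p + B*q = 0" using D(2) by simp
  have "D * (A*f + B*l + C*t + b + B*p + 2*C*q)
      = D * (A*f + B*l + C*t + b) + B*(D*p) + 2*C*(D*q)" by algebra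
  also have "\<dots> = 0" unfolding assms(9,10) unfolding assms(1-6) D(1) by algebra
  finally show "A*f + B*l + C*t + b + B*p + 2*C*q = 0" using D(2) by simp
qed

text \<open>Right multiplication by \<open>matrix_inv g\<close> mixes only the column index, so the
  symmetry in \<open>i\<close> and \<open>k\<close> that defines \<open>GL_d\<close>
  survives.\<close>

lemma GL_d_log_derivation_sym:
  assumes "g \<in> GL_d d"
  shows "(map_matrix (d $ k) g ** matrix_inv g) $ i $ j = (map_matrix (d $ i) g ** matrix_inv g) $ k $ j"
  using assms by (simp add: GL_d_def matrix_matrix_mult_def)

lemma M_mat_nth [simp]:
  "M_mat (A, B, C, a, b, c) $ 1 $ 1 = A" "M_mat (A, B, C, a, b, c) $ 1 $ 2 = B / 2"
  "M_mat (A, B, C, a, b, c) $ 2 $ 1 = B / 2" "M_mat (A, B, C, a, b, c) $ 2 $ 2 = C"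
  by simp_all

lemma constant_leading_coeffs_iff:
  fixes d :: "'a::field derivs"
  assumes "(2 :: 'a) \<noteq> 0" "derivation (d $ 1)" "derivation (d $ 2)"
  shows "{A, B, C} \<subseteq> constant_field d \<longleftrightarrow>
    (\<forall>i. map_matrix (d $ i) (M_mat (A, B, C, a, b, c)) = 0)"
  using assms
  by (auto simp: constant_field_def vec_eq_iff forall_2 derivation_divide derivation_numeral)

lemma derivation_scaled_matrix_eq_0_iff:
  fixes N :: "'a::field ^ 'n ^ 'm"
  assumes D: "derivation D" and h: "h \<noteq> 0"
  shows "map_matrix D (map_matrix (\<lambda>x. h * x) N) = 0 \<longleftrightarrow>
    map_matrix D N = map_matrix (\<lambda>x. - (D h / h) * x) N"
proof -
  have "D (h * x) = 0 \<longleftrightarrow> D x = - (D h / h) * x" for x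
    using h by (simp add: derivation_mult[OF D] field_simps eq_neg_iff_add_eq_0)
  then show ?thesis by (simp add: vec_eq_iff)
qed

text \<open>Constancy of the leading coefficients, pulled back by \<open>g\<close>, expresses the
  derivatives of \<open>A\<close>, \<open>B\<close>, \<open>C\<close> through \<open>G k\<close> and
  the logarithmic derivatives of \<open>h\<close>. This is the input of
  \<open>first_order_identity\<close>.\<close>

lemma first_order_coeffs_tau:
  fixes d :: "'a::field derivs"
  assumes two: "(2 :: 'a) \<noteq> 0" and d1: "derivation (d $ 1)" and d2: "derivation (d $ 2)"
    and V: "V = (A, B, C, a, b, c)" "discr V \<noteq> 0"
    and h: "h \<noteq> 0" and g: "g \<in> GL_d d"
    and V1: "tau d h g V = (A1, B1, C1, a1, b1, c1)"
    and const: "{A1, B1, C1} \<subseteq> constant_field d"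
    and \<mu>: "g *v \<mu> = vector [a_d d V / discr V - (d $ 1) h / h, b_d d V / discr V - (d $ 2) h / h]"
  shows "a1 = - (2 * A1 * \<mu>$1 + B1 * \<mu>$2)" "b1 = - (B1 * \<mu>$1 + 2 * C1 * \<mu>$2)"
proof -
  define G where "G k = map_matrix (d $ k) g ** matrix_inv g" for k
  define p where "p = a_d d V / discr V"
  define q where "q = b_d d V / discr V"
  have inv: "invertible g" using g by (simp add: GL_d_def)
  have Gg: "map_matrix (d $ k) g = G k ** g" for k
    unfolding G_def by (simp add: matrix_inv_mult[OF inv] flip: matrix_mul_assoc)
  have dg: "(d $ k) (g $ i $ j) = G k $ i $ 1 * g $ 1 $ j + G k $ i $ 2 * g $ 2 $ j" for k i j
    using arg_cong[OF Gg[of k], of "\<lambda>X. X $ i $ j"] by (simp add: matrix_matrix_mult_def sum_2)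
  have sym: "G 2 $ 1 $ j = G 1 $ 2 $ j" for j
    unfolding G_def by (rule GL_d_log_derivation_sym[OF g])
  have d: "derivation (d $ k)" for k using d1 d2 by (metis exhaust_2)
  have "map_matrix (d $ k) (map_matrix (\<lambda>x. h * x) (transpose g ** M_mat V ** g)) = 0" for k
    using const unfolding constant_leading_coeffs_iff[OF two d1 d2, of _ _ _ a1 b1 c1]
      M_mat_tau[OF two, of d, symmetric] V1 by (rule spec)
  then have "transpose (G k) ** M_mat V + M_mat V ** G k + map_matrix (d $ k) (M_mat V)
      - map_matrix (\<lambda>x. - ((d $ k) h / h) * x) (M_mat V) = 0" for k
    unfolding G_def congruence_derivation_iff[OF d inv] derivation_scaled_matrix_eq_0_iff[OF d h]
    by simp
  then have *: "(transpose (G k) ** M_mat V + M_mat V ** G k + map_matrix (d $ k) (M_mat V)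
      - map_matrix (\<lambda>x. - ((d $ k) h / h) * x) (M_mat V)) $ i $ j = 0" for k i j
    by simp
  define w where "w k = (d $ k) h / h" for k
  have A: "(d $ k) A = - (2 * A * G k $ 1 $ 1 + B * G k $ 2 $ 1) - w k * A" for k
    using *[of k 1 1] two
    by (simp add: V(1) w_def[symmetric] matrix_matrix_mult_def transpose_def sum_2
        del: M_mat.simps, simp add: field_simps) algebra
  have C: "(d $ k) C = - (B * G k $ 1 $ 2 + 2 * C * G k $ 2 $ 2) - w k * C" for k
    using *[of k 2 2] two
    by (simp add: V(1) w_def[symmetric] matrix_matrix_mult_def transpose_def sum_2
        del: M_mat.simps, simp add: field_simps) algebra
  have B: "(d $ k) B = - (2 * A * G k $ 1 $ 2 + B * G k $ 2 $ 2 + B * G k $ 1 $ 1 + 2 * C * G k $ 2 $ 1)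
      - w k * B" for k
  proof -
    \<comment> \<open>The off-diagonal entry of \<open>M_mat V\<close> is \<open>B / 2\<close>;
      writing \<open>B = 2 * \<beta>\<close> keeps the equation polynomial.\<close>
    define \<beta> where "\<beta> = B / 2"
    have \<beta>: "B = 2 * \<beta>" using two by (simp add: \<beta>_def)
    have "G k $ 1 $ 1 * \<beta> + G k $ 2 $ 1 * C + (A * G k $ 1 $ 2 + \<beta> * G k $ 2 $ 2) + (d $ k) \<beta> + w k * \<beta> = 0"
      using *[of k 1 2]
      by (simp add: V(1) w_def[symmetric] \<beta>_def[symmetric] matrix_matrix_mult_def transpose_def sum_2
          del: M_mat.simps)
    moreover have "(d $ k) B = 2 * (d $ k) \<beta>"
      unfolding \<beta> by (simp add: derivation_mult[OF d] derivation_numeral[OF d])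
    ultimately show ?thesis using \<beta> by algebra
  qed
  note id = first_order_identity[where D = "discr V" and p = p and q = q and a = a and b = b,
      OF A[of 1] A[of 2, unfolded sym] B[of 1] B[of 2, unfolded sym] C[of 1] C[of 2, unfolded sym]]
  have dV: "discr V = B\<^sup>2 - 4 * A * C" by (simp add: V(1))
  have p: "discr V * p = A * (d$1) C - (d$1) A * C + B * (d$2) C - (d$2) B * C - b * B + 2 * a * C"
    using V(2) unfolding p_def by (simp add: V(1))
  have q: "discr V * q = (d$1) A * B - A * (d$1) B + (d$2) A * C - A * (d$2) C - a * B + 2 * b * A"
    using V(2) unfolding q_def by (simp add: V(1))
  note id = id[OF dV V(2) p q]
  have "g$1$1 * \<mu>$1 + g$1$2 * \<mu>$2 = p - w 1" "g$2$1 * \<mu>$1 + g$2$2 * \<mu>$2 = q - w 2"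
    using \<mu> by (simp_all add: vec_eq_iff forall_2 matrix_vector_mult_def sum_2 p_def q_def w_def)
  \<comment> \<open>Solving \<open>g \<mu> = P - \<partial>h / h\<close> for the derivatives of
    \<open>h\<close> eliminates them in favour of \<open>p\<close>, \<open>q\<close> and
    \<open>\<mu>\<close>.\<close>
  then have w: "(d $ 1) h = h * (p - (g$1$1 * \<mu>$1 + g$1$2 * \<mu>$2))"
      "(d $ 2) h = h * (q - (g$2$1 * \<mu>$1 + g$2$2 * \<mu>$2))"
    using h by (simp_all add: w_def)
  have V1_nth: "A1 = fst (tau d h g V)" "B1 = fst (snd (tau d h g V))" "C1 = fst (snd (snd (tau d h g V)))"
    "a1 = fst (snd (snd (snd (tau d h g V))))" "b1 = fst (snd (snd (snd (snd (tau d h g V)))))"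
    "c1 = snd (snd (snd (snd (snd (tau d h g V)))))"
    by (simp_all add: V1)
  \<comment> \<open>The two bracketed factors vanish by \<open>first_order_identity\<close>; their
    weights are the first column of \<open>g\<close>, and the second column for \<open>b1\<close>
    below.\<close>
  have "a1 + (2 * A1 * \<mu>$1 + B1 * \<mu>$2) = h *
     (g$1$1 * (A * G 1 $ 1 $ 1 + B * G 1 $ 2 $ 1 + C * G 2 $ 2 $ 1 + a + 2 * A * p + B * q)
     + g$2$1 * (A * G 1 $ 1 $ 2 + B * G 1 $ 2 $ 2 + C * G 2 $ 2 $ 2 + b + B * p + 2 * C * q))"
    unfolding V1_nth V(1) tau.simps fst_conv snd_conv w dg by algebra
  then show "a1 = - (2 * A1 * \<mu>$1 + B1 * \<mu>$2)"
    unfolding id eq_neg_iff_add_eq_0 by simp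
  have "b1 + (B1 * \<mu>$1 + 2 * C1 * \<mu>$2) = h *
     (g$1$2 * (A * G 1 $ 1 $ 1 + B * G 1 $ 2 $ 1 + C * G 2 $ 2 $ 1 + a + 2 * A * p + B * q)
     + g$2$2 * (A * G 1 $ 1 $ 2 + B * G 1 $ 2 $ 2 + C * G 2 $ 2 $ 2 + b + B * p + 2 * C * q))"
    unfolding V1_nth V(1) tau.simps fst_conv snd_conv w dg by algebra
  then show "b1 = - (B1 * \<mu>$1 + 2 * C1 * \<mu>$2)"
    unfolding id eq_neg_iff_add_eq_0 by simp
qed

text \<open>Formally, \<open>gamma0 d V\<close> is \<open>L u / u\<close> for the operator
  \<open>L\<close> of the equation and a function \<open>u\<close> with logarithmic gradient
  \<open>(p, q)\<close>. Then \<open>v = u / h\<close> has logarithmic gradient \<open>\<mu>\<close>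
  with respect to the new derivations, and evaluating the new operator on \<open>v\<close> with
  \<open>\<mu>\<close> constant gives the formula. The proof checks this by differentiating
  \<open>\<partial>h = h (P - g \<mu>)\<close> once more.\<close>

lemma zeroth_order_coeff_tau:
  fixes d :: "'a::field derivs"
  assumes d1: "derivation (d $ 1)" and d2: "derivation (d $ 2)"
    and comm: "\<And>f. (d $ 1) ((d $ 2) f) = (d $ 2) ((d $ 1) f)"
    and V: "V = (A, B, C, a, b, c)"
    and h: "h \<noteq> 0" and g: "g \<in> GL_d d"
    and V1: "tau d h g V = (A1, B1, C1, a1, b1, c1)"
    and const: "\<mu>$1 \<in> constant_field d" "\<mu>$2 \<in> constant_field d"
    and \<mu>: "g *v \<mu> = vector [a_d d V / discr V - (d $ 1) h / h, b_d d V / discr V - (d $ 2) h / h]"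
  shows "c1 = h * gamma0 d V
    - (A1 * (\<mu>$1)\<^sup>2 + B1 * \<mu>$1 * \<mu>$2 + C1 * (\<mu>$2)\<^sup>2 + a1 * \<mu>$1 + b1 * \<mu>$2)"
proof -
  define p where "p = a_d d V / discr V"
  define q where "q = b_d d V / discr V"
  have "g$1$1 * \<mu>$1 + g$1$2 * \<mu>$2 = p - (d $ 1) h / h" "g$2$1 * \<mu>$1 + g$2$2 * \<mu>$2 = q - (d $ 2) h / h"
    using \<mu> by (simp_all add: vec_eq_iff forall_2 matrix_vector_mult_def sum_2 p_def q_def)
  then have w: "(d $ 1) h = h * (p - (g$1$1 * \<mu>$1 + g$1$2 * \<mu>$2))"
      "(d $ 2) h = h * (q - (g$2$1 * \<mu>$1 + g$2$2 * \<mu>$2))"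
    using h by simp_all
  have \<mu>0: "(d $ k) (\<mu>$1) = 0" "(d $ k) (\<mu>$2) = 0" for k
    using const exhaust_2[of k] by (auto simp: constant_field_def)
  have sym: "(d $ 2) (g $ 1 $ j) = (d $ 1) (g $ 2 $ j)" for j
    using g by (simp add: GL_d_def)
  have gamma: "gamma0 d V = A * ((d$1) p + p^2) + B * ((d$2) p + p * q) + C * ((d$2) q + q^2)
      + a * p + b * q + c"
    by (simp add: V p_def q_def Let_def)
  have h11: "(d $ 1) ((d $ 1) h) = (d $ 1) h * (p - (g$1$1 * \<mu>$1 + g$1$2 * \<mu>$2))
      + h * ((d $ 1) p - ((d $ 1) (g$1$1) * \<mu>$1 + (d $ 1) (g$1$2) * \<mu>$2))"
    by (subst w(1)) (simp add: derivation_simps d1 \<mu>0)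
  \<comment> \<open>Taking the mixed derivative in this order produces the derivative of
    \<open>p\<close> occurring in \<open>gamma0\<close>, and \<open>sym\<close> produces the
    derivatives of the second row of \<open>g\<close> occurring in \<open>a1\<close> and
    \<open>b1\<close>.\<close>
  have h21: "(d $ 2) ((d $ 1) h) = (d $ 2) h * (p - (g$1$1 * \<mu>$1 + g$1$2 * \<mu>$2))
      + h * ((d $ 2) p - ((d $ 1) (g$2$1) * \<mu>$1 + (d $ 1) (g$2$2) * \<mu>$2))"
    by (subst w(1)) (simp add: derivation_simps d2 \<mu>0 sym)
  have h22: "(d $ 2) ((d $ 2) h) = (d $ 2) h * (q - (g$2$1 * \<mu>$1 + g$2$2 * \<mu>$2))
      + h * ((d $ 2) q - ((d $ 2) (g$2$1) * \<mu>$1 + (d $ 2) (g$2$2) * \<mu>$2))"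
    by (subst w(2)) (simp add: derivation_simps d2 \<mu>0)
  have V1_nth: "A1 = fst (tau d h g V)" "B1 = fst (snd (tau d h g V))" "C1 = fst (snd (snd (tau d h g V)))"
    "a1 = fst (snd (snd (snd (tau d h g V))))" "b1 = fst (snd (snd (snd (snd (tau d h g V)))))"
    "c1 = snd (snd (snd (snd (snd (tau d h g V)))))"
    by (simp_all add: V1)
  show ?thesis
    unfolding V1_nth gamma unfolding V tau.simps fst_conv snd_conv comm h11 h21 h22 unfolding w
    by algebra
qed

section \<open>Constancy of the coefficients in terms of \<open>m_vec\<close>\<close>

lemma m_vec_eq:
  fixes d :: "'a::field derivs"
  assumes "(2 :: 'a) \<noteq> 0" and d1: "derivation (d $ 1)" and d2: "derivation (d $ 2)"
    and "discr V \<noteq> 0" "h \<noteq> 0" "det g \<noteq> 0"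
    and "discr (tau d h g V) \<in> constant_field d"
  shows "inverse (det g) * (d $ k) (det g) + 1 / 2 * inverse (discr V) * (d $ k) (discr V)
      = - ((d $ k) h / h)" (is "?l k = _")
    and "m_vec d V g = vector [a_d d V / discr V - (d $ 1) h / h, b_d d V / discr V - (d $ 2) h / h]"
proof -
  have d: "derivation (d $ k)" for k using d1 d2 by (metis exhaust_2)
  show *: "?l k = - ((d $ k) h / h)" for k
  proof -
    \<comment> \<open>The claim is half the logarithmic derivative of this constant discriminant,
      obtained by cancelling the common factor \<open>h * det g\<close>.\<close>
    have "(d $ k) (h\<^sup>2 * (det g)\<^sup>2 * discr V) = 0"
      using assms(7) exhaust_2[of k] by (auto simp: discr_tau constant_field_def)
    then have "h * det g * (2 * (d $ k) h * det g * discr V + 2 * h * (d $ k) (det g) * discr V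
        + h * det g * (d $ k) (discr V)) = 0"
      by (simp add: derivation_mult[OF d] derivation_power2[OF d], algebra)
    then have "2 * (d $ k) h * det g * discr V + 2 * h * (d $ k) (det g) * discr V
        + h * det g * (d $ k) (discr V) = 0"
      using assms by simp
    then have "h * (2 * (d $ k) (det g) * discr V + det g * (d $ k) (discr V))
      = - (d $ k) h * (2 * det g * discr V)" by algebra
    then show ?thesis
      using assms by (simp add: field_simps)
  qed
  show "m_vec d V g = vector [a_d d V / discr V - (d $ 1) h / h, b_d d V / discr V - (d $ 2) h / h]"
    using *[of 1] *[of 2] by (simp add: m_vec_def grad_def vec_eq_iff forall_2 add.assoc)
qed

text \<open>The linear system for \<open>x\<close> and \<open>y\<close> has constant coefficients
  and nonzero determinant, so Cramer's rule recovers \<open>x\<close> and \<open>y\<close>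
  rationally from constants.\<close>

lemma constant_first_order_iff:
  fixes d :: "'a::field derivs"
  assumes d1: "derivation (d $ 1)" and d2: "derivation (d $ 2)"
    and "{A, B, C} \<subseteq> constant_field d" and nz: "B\<^sup>2 - 4 * A * C \<noteq> 0"
    and a: "a = - (2 * A * x + B * y)" and b: "b = - (B * x + 2 * C * y)"
  shows "{a, b} \<subseteq> constant_field d \<longleftrightarrow> {x, y} \<subseteq> constant_field d"
proof -
  have n: "numeral n \<in> constant_field d" for n
    by (rule constant_field_numeral[OF d1 d2])
  note closed = constant_field_closed[OF d1 d2]
  have "2 * a * C - b * B = (B\<^sup>2 - 4 * A * C) * x" "2 * b * A - a * B = (B\<^sup>2 - 4 * A * C) * y"
    unfolding a b by algebra+
  \<comment> \<open>\<open>B * B\<close> replaces the square because the closure rules for constants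
    speak of products.\<close>
  then have "x = (2 * a * C - b * B) / (B * B - 4 * A * C)"
      "y = (2 * b * A - a * B) / (B * B - 4 * A * C)"
    using nz by (simp_all add: field_simps power2_eq_square)
  then have "{x, y} \<subseteq> constant_field d" if "{a, b} \<subseteq> constant_field d"
    using that assms(3) n closed by auto
  moreover have "{a, b} \<subseteq> constant_field d" if "{x, y} \<subseteq> constant_field d"
    using that assms(3) n closed by (auto simp: a b)
  ultimately show ?thesis by blast
qed

lemma deriv_vec_eq_0_iff:
  "(\<forall>i. deriv_vec (d $ i) v = 0) \<longleftrightarrow> {v $ 1, v $ 2} \<subseteq> constant_field d"
  by (auto simp: deriv_vec_def constant_field_def vec_eq_iff forall_2)

text \<open>Shared by both directions of the theorem: once the leading coefficients are constant,
  only the condition on \<open>m_vec\<close> is left.\<close>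

lemma constant_coeffs_tau_iff:
  fixes d :: "'a::field derivs"
  assumes two: "(2 :: 'a) \<noteq> 0" and d1: "derivation (d $ 1)" and d2: "derivation (d $ 2)"
    and comm: "\<And>f. (d $ 1) ((d $ 2) f) = (d $ 2) ((d $ 1) f)"
    and discr: "discr V \<noteq> 0" and gamma: "gamma0 d V = 0"
    and h: "h \<noteq> 0" and g: "g \<in> GL_d d"
    and M: "\<forall>i. map_matrix (d $ i) (map_matrix (\<lambda>x. h * x) (transpose g ** M_mat V ** g)) = 0"
  shows "constant_coeffs d (tau d h g V) \<longleftrightarrow>
      (\<forall>i. (map_matrix (d $ i) g ** matrix_inv g) *v m_vec d V g = deriv_vec (d $ i) (m_vec d V g))"
    and "inverse (det g) * (d $ i) (det g) + 1 / 2 * inverse (discr V) * (d $ i) (discr V)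
      = - ((d $ i) h / h)"
proof -
  obtain A B C a b c where V: "V = (A, B, C, a, b, c)" by (cases V)
  obtain A1 B1 C1 a1 b1 c1 where V1: "tau d h g V = (A1, B1, C1, a1, b1, c1)"
    by (cases "tau d h g V")
  have inv: "invertible g" using g by (simp add: GL_d_def)
  then have det: "det g \<noteq> 0" by (simp add: invertible_det_nz)
  have d: "derivation (d $ k)" for k using d1 d2 by (metis exhaust_2)
  note closed = constant_field_closed[OF d1 d2] constant_field_numeral[OF d1 d2]
  have const: "{A1, B1, C1} \<subseteq> constant_field d"
    using M unfolding constant_leading_coeffs_iff[OF two d1 d2, of _ _ _ a1 b1 c1]
      M_mat_tau[OF two, of d, symmetric] V1 .
  have "B1 * B1 - 4 * A1 * C1 \<in> constant_field d" using const closed by auto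
  then have D1: "discr (tau d h g V) \<in> constant_field d" by (simp add: V1 power2_eq_square)
  show "inverse (det g) * (d $ i) (det g) + 1 / 2 * inverse (discr V) * (d $ i) (discr V)
      = - ((d $ i) h / h)"
    by (rule m_vec_eq[OF two d1 d2 discr h det D1])
  define \<mu> where "\<mu> = matrix_inv g *v m_vec d V g"
  have g\<mu>: "g *v \<mu> = m_vec d V g"
    by (simp add: \<mu>_def matrix_vector_mul_assoc matrix_inv_mult[OF inv])
  note g\<mu>' = g\<mu>[unfolded m_vec_eq(2)[OF two d1 d2 discr h det D1]]
  note ab = first_order_coeffs_tau[OF two d1 d2 V discr h g V1 const g\<mu>']
  have "discr (tau d h g V) \<noteq> 0" using discr h det by (simp add: discr_tau)
  then have "B1\<^sup>2 - 4 * A1 * C1 \<noteq> 0" by (simp add: V1)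
  note ab_iff = constant_first_order_iff[OF d1 d2 const this ab]
  \<comment> \<open>\<open>gamma0 d V = 0\<close> removes the one term containing the possibly
    nonconstant \<open>h\<close>.\<close>
  have c1: "c1 \<in> constant_field d" if "{\<mu>$1, \<mu>$2} \<subseteq> constant_field d"
  proof -
    have "c1 = - (A1 * (\<mu>$1 * \<mu>$1) + B1 * \<mu>$1 * \<mu>$2 + C1 * (\<mu>$2 * \<mu>$2) + a1 * \<mu>$1 + b1 * \<mu>$2)"
      using zeroth_order_coeff_tau[OF d1 d2 comm V h g V1 _ _ g\<mu>'] that gamma
      by (simp add: power2_eq_square)
    then show ?thesis using that const ab_iff closed by auto
  qed
  show "constant_coeffs d (tau d h g V) \<longleftrightarrow>
      (\<forall>i. (map_matrix (d $ i) g ** matrix_inv g) *v m_vec d V g = deriv_vec (d $ i) (m_vec d V g))"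
    unfolding derivation_coordinates_iff[OF d inv g\<mu>] deriv_vec_eq_0_iff
    using const ab_iff c1 by (auto simp: V1)
qed

section \<open>Equivalence with the two systems for \<open>g\<close>\<close>

theorem corollary3p5:
  fixes d :: "'a::field derivs" and V :: "'a coeffs"
  assumes "CHAR('a) \<noteq> 2"
    and "commuting_independent_derivations d"
    and "discr V \<noteq> 0"
    and "(d $ 2) (a_d d V / discr V) = (d $ 1) (b_d d V / discr V)"
    and "gamma0 d V = 0"
  shows "(\<exists>\<delta> V\<^sub>1. G_equivalent d V \<delta> V\<^sub>1 \<and> constant_coeffs d V\<^sub>1) \<longleftrightarrow>
    (\<exists>g \<in> GL_d d.
      (\<forall>i.
        transpose (map_matrix (d $ i) g ** matrix_inv g) ** M_mat V
        + M_mat V ** (map_matrix (d $ i) g ** matrix_inv g)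
        + map_matrix (d $ i) (M_mat V)
        - map_matrix (\<lambda>x. (inverse (det g) * (d $ i) (det g)
              + 1 / 2 * inverse (discr V) * (d $ i) (discr V)) * x) (M_mat V) = 0) \<and>
      (\<forall>i.
        (map_matrix (d $ i) g ** matrix_inv g) *v m_vec d V g
        = deriv_vec (d $ i) (m_vec d V g)))"
    (is "?equiv \<longleftrightarrow> (\<exists>g \<in> GL_d d. ?M g \<and> ?m g)")
proof -
  have two: "(2 :: 'a) \<noteq> 0" using assms(1) by (simp add: two_neq_0_iff_CHAR)
  have d1: "derivation (d $ 1)" and d2: "derivation (d $ 2)"
    and comm: "\<And>f. (d $ 1) ((d $ 2) f) = (d $ 2) ((d $ 1) f)"
    using assms(2) by (auto simp: commuting_independent_derivations_def)
  have d: "derivation (d $ k)" for k using d1 d2 by (metis exhaust_2)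
  define N :: "'a ^ 2 ^ 2 \<Rightarrow> 'a ^ 2 ^ 2" where "N g = transpose g ** M_mat V ** g" for g
  define l :: "'a ^ 2 ^ 2 \<Rightarrow> 2 \<Rightarrow> 'a" where "l g i = inverse (det g) * (d $ i) (det g)
      + 1 / 2 * inverse (discr V) * (d $ i) (discr V)" for g i
  \<comment> \<open>After congruence by \<open>g\<close>, the first system says that every entry
    \<open>n\<close> of \<open>N g\<close> satisfies \<open>\<partial>n = l n\<close> with one
    common factor \<open>l g i\<close> for each derivation.\<close>
  have M_iff: "?M g \<longleftrightarrow> (\<forall>i. map_matrix (d $ i) (N g) = map_matrix (\<lambda>x. l g i * x) (N g))"
    if "invertible g" for g
    unfolding N_def l_def congruence_derivation_iff[OF d that] ..
  have equiv: "?equiv \<longleftrightarrow> (\<exists>h g. h \<noteq> 0 \<and> g \<in> GL_d d \<and> constant_coeffs d (tau d h g V))"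
    unfolding G_equivalent_def by blast
  note tau_iff = constant_coeffs_tau_iff[OF two d1 d2 comm assms(3,5), folded N_def l_def]
  show ?thesis
  proof
    assume ?equiv
    then obtain h g where h: "h \<noteq> 0" and g: "g \<in> GL_d d" and const: "constant_coeffs d (tau d h g V)"
      unfolding equiv by blast
    have inv: "invertible g" using g by (simp add: GL_d_def)
    obtain A1 B1 C1 a1 b1 c1 where V1: "tau d h g V = (A1, B1, C1, a1, b1, c1)"
      by (cases "tau d h g V")
    have "{A1, B1, C1} \<subseteq> constant_field d" using const by (simp add: V1)
    then have hN: "\<forall>i. map_matrix (d $ i) (map_matrix (\<lambda>x. h * x) (N g)) = 0"
      unfolding constant_leading_coeffs_iff[OF two d1 d2, of _ _ _ a1 b1 c1] N_def
        M_mat_tau[OF two, of d, symmetric] V1 .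
    have "?M g"
      unfolding M_iff[OF inv] tau_iff(2)[OF h g hN]
      using hN derivation_scaled_matrix_eq_0_iff[OF d h] by blast
    moreover have "?m g" using const tau_iff(1)[OF h g hN] by blast
    ultimately show "\<exists>g \<in> GL_d d. ?M g \<and> ?m g" using g by blast
  next
    assume "\<exists>g \<in> GL_d d. ?M g \<and> ?m g"
    then obtain g where g: "g \<in> GL_d d" and M: "?M g" and m: "?m g" by blast
    have inv: "invertible g" using g by (simp add: GL_d_def)
    have dN: "map_matrix (d $ i) (N g) = map_matrix (\<lambda>x. l g i * x) (N g)" for i
      using M unfolding M_iff[OF inv] by blast
    \<comment> \<open>A zero matrix would have zero discriminant.\<close>
    have "M_mat V \<noteq> 0"
      using assms(3) two by (cases V) (auto simp: vec_eq_iff forall_2)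
    then have "N g \<noteq> 0" unfolding N_def congruence_eq_0_iff[OF inv] .
    then obtain j k where n: "N g $ j $ k \<noteq> 0" by (auto simp: vec_eq_iff)
    define h where "h = inverse (N g $ j $ k)"
    have h: "h \<noteq> 0" using n by (simp add: h_def)
    have "(d $ i) (N g $ j $ k) = l g i * N g $ j $ k" for i
      using arg_cong[OF dN[of i], of "\<lambda>X. X $ j $ k"] by simp
    \<comment> \<open>Inverting an entry flips the sign of its logarithmic derivative, so in the
      product rule for \<open>h * N g\<close> the two contributions cancel.\<close>
    then have "(d $ i) h = - l g i * h" for i
      using n by (simp add: h_def derivation_inverse[OF d] power2_eq_square)
    then have "- ((d $ i) h / h) = l g i" for i
      using h by simp
    then have hN: "\<forall>i. map_matrix (d $ i) (map_matrix (\<lambda>x. h * x) (N g)) = 0"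
      unfolding derivation_scaled_matrix_eq_0_iff[OF d h] using dN by simp
    show ?equiv
      unfolding equiv using h g m tau_iff(1)[OF h g hN] by blast
  qed
qed

end
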